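(* Let $b=200526827$. The statement $$\Bigl(164\cdot 165,\ (164\cdot 165)^2,\ 164,\ 165,\ 132,\ 133,\ 132\cdot 133,\ (132\cdot 133)^2,\ 143,\ 144,\ 143\cdot 144,\ (143\cdot 144)^2,\ 132\cdot 133\cdot 143\cdot 144,$$ $$b,\ 2b,\ 2b-1,\ 3b-1,\ (2b-1)(3b-1),\ \frac{(2b-1)(3b-1)}{132\cdot 133\cdot 143\cdot 144},\ 1\Bigr)\in B_{20}(\mathbb{Z})$$ is equivalent to the following statement: the only integer triples $(x,y,z)$ which solve the system $$x^2(x+1)^2+y^2(y+1)^2=z^2(z+1)^2,\qquad x(x+1)y(y+1)\neq 0$$ are the triples $$(x,y,z)\in\Bigl(\{-133,132\}\times\{-144,143\}\times\{-165,164\}\Bigr)\cup\Bigl(\{-144,143\}\times\{-133,132\}\times\{-165,164\}\Bigr).$$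
   Context: For $K\subseteq\mathbb{C}$ and a positive integer $n$, $B_n(K)$ denotes the set of all $(x_1,\ldots,x_n)\in K^n$ such that for each $y_1,\ldots,y_n\in K$ the conjunction of the three conditions (1) for all $i\in\{1,\ldots,n\}$: $x_i=1\Rightarrow y_i=1$; (2) for all $i,j,k\in\{1,\ldots,n\}$: $x_i+x_j=x_k\Rightarrow y_i+y_j=y_k$; (3) for all $i,j,k\in\{1,\ldots,n\}$: $x_i\cdot x_j=x_k\Rightarrow y_i\cdot y_j=y_k$ implies that $x_1=y_1$. For $b=200526827$ one has $667378345\cdot(132\cdot 133\cdot 143\cdot 144)=(2b-1)(3b-1)$, so the tuple in the claim has integer entries. *)

theory Defs
  imports Complex_Main
begin

text \<open>
  \<open>B n K\<close> is the set written $B_n(K)$ in the paper, for \<open>n \<ge> 1\<close>. An $n$-tuple over \<open>K\<close>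
  is a list of length \<open>n\<close> with entries in \<open>K\<close>; list positions start at 0, so the component
  $x_i$ is \<open>xs ! (i - 1)\<close> and the distinguished first component $x_1$ is \<open>xs ! 0\<close>.
\<close>

definition B :: "nat \<Rightarrow> complex set \<Rightarrow> complex list set" where
  "B n K = {xs. length xs = n \<and> set xs \<subseteq> K \<and>
     (\<forall>ys. length ys = n \<and> set ys \<subseteq> K \<longrightarrow>
        (\<forall>i<n. xs ! i = 1 \<longrightarrow> ys ! i = 1) \<and>
        (\<forall>i<n. \<forall>j<n. \<forall>k<n. xs ! i + xs ! j = xs ! k \<longrightarrow> ys ! i + ys ! j = ys ! k) \<and>
        (\<forall>i<n. \<forall>j<n. \<forall>k<n. xs ! i * xs ! j = xs ! k \<longrightarrow> ys ! i * ys ! j = ys ! k)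
        \<longrightarrow> xs ! 0 = ys ! 0)}"

end

theory Submission
  imports Defs "HOL-Computational_Algebra.Primes"
begin

text \<open>
  The relations obeyed by the tuple say exactly that a second tuple has the form
  \<open>Z, Z\<^sup>2, z, z + 1, x, x + 1, X, X\<^sup>2, y, y + 1, Y, Y\<^sup>2, XY, \<dots>\<close> with \<open>X = x (x + 1)\<close>,
  \<open>Y = y (y + 1)\<close>, \<open>Z = z (z + 1)\<close>, \<open>X\<^sup>2 + Y\<^sup>2 = Z\<^sup>2\<close>, and that \<open>XY\<close> divides
  \<open>(2 b - 1) (3 b - 1)\<close> for some integer \<open>b\<close>. As \<open>2 b - 1\<close> and \<open>3 b - 1\<close> have no integer root,
  the last relation forces \<open>XY \<noteq> 0\<close>; conversely every nonzero integer divides such a product.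
  Hence the tuple lies in \<open>B\<^sub>2\<^sub>0(\<int>)\<close> iff every solution has \<open>z (z + 1) = 164 \<sqdot> 165\<close>, and
  only finitely many triples satisfy that.
\<close>

text \<open>This is the premise inside \<open>B\<close>, stated over any semiring so that it applies
  to complex lists and to integer lists alike.\<close>

definition obeys :: "'a::semiring_1 list \<Rightarrow> 'a list \<Rightarrow> bool" where
  "obeys xs ys \<longleftrightarrow> length ys = length xs \<and>
     (\<forall>i<length xs. xs ! i = 1 \<longrightarrow> ys ! i = 1) \<and>
     (\<forall>i<length xs. \<forall>j<length xs. \<forall>k<length xs. xs ! i + xs ! j = xs ! k \<longrightarrow> ys ! i + ys ! j = ys ! k) \<and>
     (\<forall>i<length xs. \<forall>j<length xs. \<forall>k<length xs. xs ! i * xs ! j = xs ! k \<longrightarrow> ys ! i * ys ! j = ys ! k)"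

lemma obeys_map_of_int:
  "obeys (map of_int xs) (map of_int ys :: 'a::ring_char_0 list) \<longleftrightarrow> obeys xs ys"
proof (cases "length ys = length xs")
  case True
  have "(of_int a + of_int b = (of_int c :: 'a)) = (a + b = c)"
    "(of_int a * of_int b = (of_int c :: 'a)) = (a * b = c)" for a b c
    by (metis of_int_add of_int_eq_iff, metis of_int_mult of_int_eq_iff)
  with True show ?thesis
    by (simp add: obeys_def)
qed (simp add: obeys_def)

text \<open>A complex list with entries in \<open>\<int>\<close> is the image of an
  \<open>int\<close> list, and \<open>of_int\<close> preserves and reflects the three relations.
  Membership thus becomes a question about \<open>int\<close>, where the relations can be
  computed.\<close>

lemma map_of_int_in_B_Ints_iff:
  fixes xs :: "int list"
  assumes "xs \<noteq> []"
  shows "map of_int xs \<in> B (length xs) \<int> \<longleftrightarrow> (\<forall>ys. obeys xs ys \<longrightarrow> ys ! 0 = xs ! 0)"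
proof -
  have lift: "\<exists>ys'. ys = map of_int ys'" if "set ys \<subseteq> \<int>" for ys :: "complex list"
    using that by (metis Ints_def ex_map_conv subset_iff rangeE)
  have "map of_int xs \<in> B (length xs) \<int> \<longleftrightarrow>
      (\<forall>ys :: complex list. set ys \<subseteq> \<int> \<and> obeys (map of_int xs) ys \<longrightarrow> of_int (xs ! 0) = ys ! 0)"
    using assms by (auto simp: B_def obeys_def)
  also have "\<dots> \<longleftrightarrow> (\<forall>ys. obeys (map of_int xs) (map of_int ys :: complex list) \<longrightarrow>
      (of_int (xs ! 0) :: complex) = map of_int ys ! 0)"
  proof (intro iffI allI impI; (elim conjE)?)
    fix ys :: "int list"
    assume *: "\<forall>ys :: complex list. set ys \<subseteq> \<int> \<and> obeys (map of_int xs) ys \<longrightarrow> of_int (xs ! 0) = ys ! 0"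
      and "obeys (map of_int xs) (map of_int ys :: complex list)"
    moreover have "set (map of_int ys :: complex list) \<subseteq> \<int>" by auto
    ultimately show "(of_int (xs ! 0) :: complex) = map of_int ys ! 0" by blast
  next
    fix ys :: "complex list"
    assume "\<forall>ys. obeys (map of_int xs) (map of_int ys :: complex list) \<longrightarrow>
      (of_int (xs ! 0) :: complex) = map of_int ys ! 0"
      and "set ys \<subseteq> \<int>" "obeys (map of_int xs) ys"
    then show "of_int (xs ! 0) = ys ! 0" using lift by blast
  qed
  also have "\<dots> \<longleftrightarrow> (\<forall>ys. obeys xs ys \<longrightarrow> ys ! 0 = xs ! 0)"
  proof -
    have "(map of_int ys ! 0 :: complex) = of_int (ys ! 0)" if "obeys xs ys" for ys
      using that assms by (cases ys) (auto simp: obeys_def)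
    then show ?thesis by (auto simp: obeys_map_of_int)
  qed
  finally show ?thesis .
qed

definition sum_triples :: "'a::semiring_1 list \<Rightarrow> (nat \<times> nat \<times> nat) list" where
  "sum_triples xs = [(i, j, k). (i, a) \<leftarrow> enumerate 0 xs, (j, b) \<leftarrow> enumerate 0 xs, (k, c) \<leftarrow> enumerate 0 xs,
     a + b = c]"

text \<open>Products with a factor 1 are left out: on a distinct list they hold as soon as 1 is preserved.\<close>

definition product_triples :: "'a::semiring_1 list \<Rightarrow> (nat \<times> nat \<times> nat) list" where
  "product_triples xs = [(i, j, k). (i, a) \<leftarrow> enumerate 0 xs, a \<noteq> 1, (j, b) \<leftarrow> enumerate 0 xs, b \<noteq> 1,
     (k, c) \<leftarrow> enumerate 0 xs, a * b = c]"

lemma set_enumerate_0: "set (enumerate 0 xs) = (\<lambda>i. (i, xs ! i)) ` {..<length xs}"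
  by (auto simp: in_set_enumerate_eq)

lemma set_sum_triples:
  "set (sum_triples xs) = {(i, j, k). i < length xs \<and> j < length xs \<and> k < length xs \<and> xs ! i + xs ! j = xs ! k}"
  by (auto simp: sum_triples_def set_enumerate_0 split: if_splits)

lemma set_product_triples:
  "set (product_triples xs) = {(i, j, k). i < length xs \<and> j < length xs \<and> k < length xs \<and>
     xs ! i \<noteq> 1 \<and> xs ! j \<noteq> 1 \<and> xs ! i * xs ! j = xs ! k}"
  by (auto simp: product_triples_def set_enumerate_0 split: if_splits)

text \<open>This replaces the quantifiers over all index triples by two lists that can be evaluated.
  Distinctness makes \<open>u\<close> the only index of the entry 1, and a product with that factor
  relates an index to itself.\<close>

lemma obeys_iff:
  assumes "distinct xs" "u < length xs" "xs ! u = 1"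
  shows "obeys xs ys \<longleftrightarrow> length ys = length xs \<and> ys ! u = 1 \<and>
    (\<forall>(i, j, k) \<in> set (sum_triples xs). ys ! i + ys ! j = ys ! k) \<and>
    (\<forall>(i, j, k) \<in> set (product_triples xs). ys ! i * ys ! j = ys ! k)"
proof -
  have same: "xs ! i = xs ! j \<longleftrightarrow> i = j" if "i < length xs" "j < length xs" for i j
    using assms that by (simp add: nth_eq_iff_index_eq)
  have u: "xs ! i = 1 \<longleftrightarrow> i = u" if "i < length xs" for i
    using same[OF that assms(2)] assms(3) by simp
  have "(xs ! i * xs ! j = xs ! k \<longrightarrow> ys ! i * ys ! j = ys ! k)"
    if "i < length xs" "j < length xs" "k < length xs" "ys ! u = 1"
      "\<forall>(i, j, k) \<in> set (product_triples xs). ys ! i * ys ! j = ys ! k" for i j k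
  proof (cases "i = u \<or> j = u")
    case True
    then show ?thesis using that assms same by auto
  next
    case False
    then show ?thesis using that u unfolding set_product_triples by blast
  qed
  then show ?thesis
    using assms u unfolding obeys_def set_sum_triples set_product_triples by (auto; blast)
qed

text \<open>Since 3 is invertible modulo a power of 2 and 2 is invertible modulo an odd number,
  \<open>3 * b - 1\<close> can absorb the 2-part of \<open>n\<close> and \<open>2 * b - 1\<close>
  the odd part.\<close>

lemma dvd_two_three:
  fixes n :: int
  assumes "n \<noteq> 0"
  obtains b where "n dvd (2 * b - 1) * (3 * b - 1)"
proof -
  obtain m where m: "n = 2 ^ multiplicity 2 n * m" "\<not> 2 dvd m"
    using multiplicity_decompose'[of n 2] assms by auto
  define t :: int where "t = 2 ^ multiplicity 2 n"
  have "coprime (2 * t) (3 * m)"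
    unfolding t_def power_Suc[symmetric] using m(2) by (simp add: coprime_left_2_iff_odd)
  then obtain u v where uv: "u * (2 * t) + v * (3 * m) = 1"
    using bezout_int[of "2 * t" "3 * m"] by auto
  \<comment> \<open>\<open>b\<close> is chosen so that \<open>2 b - 1 = - v m\<close> and \<open>3 b - 1 = u t\<close>.\<close>
  have "2 * (u * t + v * m) - 1 = - v * m" "3 * (u * t + v * m) - 1 = u * t"
    using uv by (simp_all add: algebra_simps)
  then have "(2 * (u * t + v * m) - 1) * (3 * (u * t + v * m) - 1) = n * (- u * v)"
    using m(1) unfolding t_def[symmetric] by (simp only:) (simp add: mult.commute)
  then show ?thesis using that by (metis dvd_triv_left)
qed

definition tuple :: "int list" where
  "tuple = [27060, 732243600, 164, 165, 132, 133, 17556, 308213136, 143, 144, 20592, 424030464,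
     361513152, 200526827, 401053654, 401053653, 601580480, 241266049077493440, 667378345, 1]"

lemma length_tuple: "length tuple = 20"
  by (simp add: tuple_def)

text \<open>The evaluation certifies that no numerical coincidence adds a relation: (7, 11, 1) and
  its mirror image give \<open>X\<^sup>2 + Y\<^sup>2 = Z\<^sup>2\<close>, and the other triples only
  build successors and the chain from \<open>b\<close> to \<open>3 b - 1\<close>.\<close>

lemma sum_triples_tuple: "sum_triples tuple =
  [(2, 19, 3), (4, 19, 5), (7, 11, 1), (8, 19, 9), (11, 7, 1), (13, 13, 14), (13, 15, 16), (15, 13, 16),
   (15, 19, 14), (19, 2, 3), (19, 4, 5), (19, 8, 9), (19, 15, 14)]"
  by code_simp

lemma product_triples_tuple: "product_triples tuple =
  [(0, 0, 1), (2, 3, 0), (3, 2, 0), (4, 5, 6), (5, 4, 6), (6, 6, 7), (6, 10, 12), (8, 9, 10), (9, 8, 10),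
   (10, 6, 12), (10, 10, 11), (12, 18, 17), (15, 16, 17), (16, 15, 17), (18, 12, 17)]"
  by code_simp

lemma obeys_tuple_iff:
  "obeys tuple ys \<longleftrightarrow> length ys = 20 \<and> ys ! 19 = 1 \<and>
     (\<forall>(i, j, k) \<in> set (sum_triples tuple). ys ! i + ys ! j = ys ! k) \<and>
     (\<forall>(i, j, k) \<in> set (product_triples tuple). ys ! i * ys ! j = ys ! k)"
proof -
  have "distinct tuple" "tuple ! 19 = 1"
    by (simp_all add: tuple_def)
  with length_tuple show ?thesis
    using obeys_iff[of tuple 19 ys] by simp
qed

abbreviation (input) solution :: "int \<Rightarrow> int \<Rightarrow> int \<Rightarrow> bool" where
  "solution x y z \<equiv> x\<^sup>2 * (x + 1)\<^sup>2 + y\<^sup>2 * (y + 1)\<^sup>2 = z\<^sup>2 * (z + 1)\<^sup>2 \<and> x * (x + 1) * y * (y + 1) \<noteq> 0"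

lemma obeys_tuple_imp_solution:
  assumes "obeys tuple ys"
  shows "solution (ys ! 4) (ys ! 8) (ys ! 2)" "ys ! 0 = ys ! 2 * (ys ! 2 + 1)"
proof -
  note eqs = assms[unfolded obeys_tuple_iff sum_triples_tuple product_triples_tuple, simplified]
  show "ys ! 0 = ys ! 2 * (ys ! 2 + 1)"
    using eqs by metis
  have X: "ys ! 6 = ys ! 4 * (ys ! 4 + 1)" and Y: "ys ! 10 = ys ! 8 * (ys ! 8 + 1)"
    and b: "ys ! 15 + 1 = 2 * ys ! 13" "ys ! 16 = ys ! 13 + ys ! 15"
    using eqs by (metis, metis, simp_all)
  \<comment> \<open>With \<open>b = ys ! 13\<close>, the entries 15 and 16 are
    \<open>2 b - 1\<close> and \<open>3 b - 1\<close>; the first is nonzero modulo 2, the second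
    modulo 3.\<close>
  have "odd (ys ! 15)" using b(1) by presburger
  moreover have "ys ! 16 \<noteq> 0" using b by presburger
  ultimately have "ys ! 15 * ys ! 16 \<noteq> 0" by auto
  moreover have "ys ! 15 * ys ! 16 = ys ! 6 * ys ! 10 * ys ! 18"
    using eqs by metis
  ultimately have nonzero: "ys ! 6 * ys ! 10 \<noteq> 0" by auto
  have "(ys ! 6)\<^sup>2 + (ys ! 10)\<^sup>2 = (ys ! 0)\<^sup>2"
    using eqs by (metis power2_eq_square)
  with nonzero show "solution (ys ! 4) (ys ! 8) (ys ! 2)"
    unfolding X Y \<open>ys ! 0 = ys ! 2 * (ys ! 2 + 1)\<close> by (simp add: power_mult_distrib mult.assoc)
qed

lemma solution_imp_obeys_tuple:
  assumes "solution x y z"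
  obtains ys where "obeys tuple ys" "ys ! 0 = z * (z + 1)"
proof -
  define X Y Z where "X = x * (x + 1)" "Y = y * (y + 1)" "Z = z * (z + 1)"
  have "X\<^sup>2 + Y\<^sup>2 = Z\<^sup>2" "X * Y \<noteq> 0"
    using assms by (simp_all add: X_Y_Z_def power_mult_distrib)
  obtain b where "X * Y dvd (2 * b - 1) * (3 * b - 1)"
    using dvd_two_three \<open>X * Y \<noteq> 0\<close> by metis
  then obtain q where q: "(2 * b - 1) * (3 * b - 1) = X * Y * q" ..
  \<comment> \<open>The entries follow the layout of \<open>tuple\<close>, with the cofactor
    \<open>q\<close> at position 18.\<close>
  define ys where "ys = [Z, Z\<^sup>2, z, z + 1, x, x + 1, X, X\<^sup>2, y, y + 1, Y, Y\<^sup>2, X * Y,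
    b, 2 * b, 2 * b - 1, 3 * b - 1, (2 * b - 1) * (3 * b - 1), q, 1]"
  have "obeys tuple ys"
    unfolding obeys_tuple_iff sum_triples_tuple product_triples_tuple ys_def
    using q \<open>X\<^sup>2 + Y\<^sup>2 = Z\<^sup>2\<close>
    by (simp add: power2_eq_square mult.commute X_Y_Z_def[symmetric] del: mult_eq_0_iff)
  then show ?thesis using that by (simp add: ys_def X_Y_Z_def)
qed

text \<open>This is the finite search behind the classification, with
  \<open>27060 = 164 * 165\<close>.\<close>

lemma pronic_pairs:
  "[(x, y). x \<leftarrow> [1..164::int], y \<leftarrow> [1..164::int], (x * (x + 1))\<^sup>2 + (y * (y + 1))\<^sup>2 = 27060\<^sup>2]
   = [(132, 143), (143, 132)]"
  by code_simp

text \<open>The reflection of \<open>x\<close> to \<open>- x - 1\<close> preserves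
  \<open>x * (x + 1)\<close>, so the search may be confined to positive integers.\<close>

lemma ex_pos_pronic:
  fixes x :: int
  assumes "x * (x + 1) \<noteq> 0"
  obtains x' where "x' > 0" "x' * (x' + 1) = x * (x + 1)"
proof (cases "x > 0")
  case False
  with assms have "- x - 1 > 0" by (cases "x = -1") auto
  moreover have "(- x - 1) * (- x - 1 + 1) = x * (x + 1)" by (simp add: algebra_simps)
  ultimately show ?thesis using that by blast
qed (use that in blast)

lemma pronic_eq_iff: "x * (x + 1) = a * (a + 1) \<longleftrightarrow> x \<in> {- (a + 1), a}" for a x :: int
proof -
  have "x * (x + 1) - a * (a + 1) = (x + (a + 1)) * (x - a)" by (simp add: algebra_simps)
  then show ?thesis by (metis (no_types) add_eq_0_iff2 eq_iff_diff_eq_0 insert_iff mult_eq_0_iff singletonD)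
qed

lemma pronic_sum_squares_27060:
  fixes x y :: int
  assumes sum: "(x * (x + 1))\<^sup>2 + (y * (y + 1))\<^sup>2 = 27060\<^sup>2"
    and nonzero: "x * (x + 1) * (y * (y + 1)) \<noteq> 0"
  shows "x \<in> {-133, 132} \<and> y \<in> {-144, 143} \<or> x \<in> {-144, 143} \<and> y \<in> {-133, 132}"
proof -
  obtain x' where x': "x' > 0" "x' * (x' + 1) = x * (x + 1)"
    using nonzero ex_pos_pronic by (metis mult_eq_0_iff)
  obtain y' where y': "y' > 0" "y' * (y' + 1) = y * (y + 1)"
    using nonzero ex_pos_pronic by (metis mult_eq_0_iff)
  \<comment> \<open>Already \<open>165 * 166 = 27390\<close> exceeds 27060.\<close>
  have bound: "a \<le> 164" if "a > 0" "(a * (a + 1))\<^sup>2 \<le> 27060\<^sup>2" for a :: int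
  proof (rule ccontr)
    assume "\<not> a \<le> 164"
    then have "165 * 166 \<le> a * (a + 1)" by (intro mult_mono) auto
    moreover have "a * (a + 1) \<le> 27060" using that(2) by (rule power2_le_imp_le) simp
    ultimately show False by simp
  qed
  have sum': "(x' * (x' + 1))\<^sup>2 + (y' * (y' + 1))\<^sup>2 = 27060\<^sup>2"
    using sum x'(2) y'(2) by simp
  then have "(x' * (x' + 1))\<^sup>2 \<le> 27060\<^sup>2" "(y' * (y' + 1))\<^sup>2 \<le> 27060\<^sup>2"
    by (metis le_add_same_cancel1 zero_le_power2, metis le_add_same_cancel2 zero_le_power2)
  then have "x' \<in> {1..164}" "y' \<in> {1..164}"
    using bound x'(1) y'(1) by auto
  then have "(x', y') \<in> set [(x, y). x \<leftarrow> [1..164::int], y \<leftarrow> [1..164::int],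
      (x * (x + 1))\<^sup>2 + (y * (y + 1))\<^sup>2 = 27060\<^sup>2]"
    using sum' by force
  then have "x' = 132 \<and> y' = 143 \<or> x' = 143 \<and> y' = 132"
    unfolding pronic_pairs by simp
  \<comment> \<open>Each positive value found is pulled back to itself and its reflection.\<close>
  then show ?thesis
    using x'(2) y'(2) pronic_eq_iff[of x 132] pronic_eq_iff[of y 132]
      pronic_eq_iff[of x 143] pronic_eq_iff[of y 143] by auto
qed

theorem theorem1:
  fixes b :: complex
  assumes "b = 200526827"
  shows
    "[164 * 165, (164 * 165)\<^sup>2, 164, 165,
      132, 133, 132 * 133, (132 * 133)\<^sup>2,
      143, 144, 143 * 144, (143 * 144)\<^sup>2,
      132 * 133 * 143 * 144,
      b, 2 * b, 2 * b - 1, 3 * b - 1, (2 * b - 1) * (3 * b - 1),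
      ((2 * b - 1) * (3 * b - 1)) / (132 * 133 * 143 * 144), 1] \<in> B 20 \<int>
     \<longleftrightarrow>
     {(x :: int, y :: int, z :: int).
        x\<^sup>2 * (x + 1)\<^sup>2 + y\<^sup>2 * (y + 1)\<^sup>2 = z\<^sup>2 * (z + 1)\<^sup>2 \<and>
        x * (x + 1) * y * (y + 1) \<noteq> 0}
     = ({-133, 132} \<times> {-144, 143} \<times> {-165, 164}) \<union>
       ({-144, 143} \<times> {-133, 132} \<times> {-165, 164})"
    (is "?xs \<in> _ \<longleftrightarrow> ?S = ?R")
proof -
  have "?xs = map of_int tuple"
    by (simp add: assms tuple_def)
  then have "?xs \<in> B 20 \<int> \<longleftrightarrow> (\<forall>ys. obeys tuple ys \<longrightarrow> ys ! 0 = 27060)"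
    using map_of_int_in_B_Ints_iff[of tuple, unfolded length_tuple] by (simp add: tuple_def)
  also have "\<dots> \<longleftrightarrow> (\<forall>x y z. solution x y z \<longrightarrow> z * (z + 1) = 27060)"
    using obeys_tuple_imp_solution solution_imp_obeys_tuple by metis
  also have "\<dots> \<longleftrightarrow> ?S = ?R"
  proof
    assume *: "\<forall>x y z. solution x y z \<longrightarrow> z * (z + 1) = 27060"
    have "(x, y, z) \<in> ?R" if "solution x y z" for x y z
    proof -
      have z: "z * (z + 1) = 27060" using that * by blast
      have "(x * (x + 1))\<^sup>2 + (y * (y + 1))\<^sup>2 = (z * (z + 1))\<^sup>2" "x * (x + 1) * (y * (y + 1)) \<noteq> 0"
        using that by (simp_all add: power_mult_distrib)
      note xy = pronic_sum_squares_27060[OF this[unfolded z]]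
      have "z \<in> {-165, 164}"
        using z pronic_eq_iff[of z 164] by simp
      with xy show ?thesis by blast
    qed
    \<comment> \<open>All listed triples reduce to
      \<open>17556\<^sup>2 + 20592\<^sup>2 = 27060\<^sup>2\<close>.\<close>
    moreover have "?R \<subseteq> ?S" by auto
    ultimately show "?S = ?R" by blast
  next
    assume eq: "?S = ?R"
    have "z \<in> {-165, 164}" if "solution x y z" for x y z
    proof -
      have "(x, y, z) \<in> ?S" unfolding mem_Collect_eq prod.case by (fact that)
      then have "(x, y, z) \<in> ?R" unfolding eq .
      then show ?thesis by blast
    qed
    moreover have "z * (z + 1) = 27060" if "z \<in> {-165, 164}" for z :: int
      using that by auto
    ultimately show "\<forall>x y z. solution x y z \<longrightarrow> z * (z + 1) = 27060" by blast
  qed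
  finally show ?thesis .
qed

end
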